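(* Let $\alpha>0$ be a non-integer, let $a<b$ be real numbers with $b-a\in\mathbb{Z}$, and put $D=\mathbb{N}_a\cap{}_b\mathbb{N}=\{a,a+1,\dots,b\}$. Let $L:D\times\mathbb{R}\times\mathbb{R}\to\mathbb{R}$, $(t,u,v)\mapsto L(t,u,v)$, be such that $L(t,\cdot,\cdot)$ is differentiable on $\mathbb{R}^2$ for each $t\in D$. Let $A\in\mathbb{R}$ and $S=\{y:D\to\mathbb{R}\ \text{bounded},\ y(a)=A\}$. Assume that the functional $$J(y)=\sum_{t=a+1}^{b-1}L\big(t,y(t),(\nabla_{a-1}^{\alpha}y)(t)\big)$$ has a local extremum in $S$ at some $f\in S$. Then $$L_1(s)+({}_b\nabla^{\alpha}L_2)(s)=0\qquad\text{for all } s\in\mathbb{N}_{a+1}\cap{}_{b-1}\mathbb{N}=\{a+1,\dots,b-1\},$$ where $L_1(s)=\dfrac{\partial L}{\partial u}\big(s,f(s),(\nabla_{a-1}^{\alpha}f)(s)\big)$ and $L_2(s)=\dfrac{\partial L}{\partial v}\big(s,f(s),(\nabla_{a-1}^{\alpha}f)(s)\big)$.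
   Context: Notation: $\mathbb{N}_a=\{a,a+1,\dots\}$, ${}_b\mathbb{N}=\{b,b-1,\dots\}$; $\rho(t)=t-1$; $\nabla h(t)=h(t)-h(t-1)$; $\Delta h(t)=h(t+1)-h(t)$; $n=[\alpha]+1$ with $[\alpha]$ the integer part of $\alpha$. Rising function: $t^{\overline{\beta}}=\Gamma(t+\beta)/\Gamma(t)$. Empty sums are $0$ (so the fractional sums below vanish where their summation range is empty). The nabla left fractional difference of order $\alpha$ starting from $c$ is $$(\nabla_c^{\alpha}y)(t)=\nabla^n\left[\frac{1}{\Gamma(n-\alpha)}\sum_{s=c+1}^{t}(t-\rho(s))^{\overline{n-\alpha-1}}y(s)\right],\qquad t\in\mathbb{N}_{c+1},$$ where $\nabla^n$ acts in the variable $t$. It is used with $c=a-1$, so only values $y(a),y(a+1),\dots$ enter. The nabla right fractional difference of order $\alpha$ ending at $b$ is $$({}_b\nabla^{\alpha}g)(t)=(-1)^n\Delta^n\left[\frac{1}{\Gamma(n-\alpha)}\sum_{s=t}^{b-1}(s-\rho(t))^{\overline{n-\alpha-1}}g(s)\right],\qquad t\in{}_{b-1}\mathbb{N},$$ where $\Delta^n$ acts in the variable $t$. "Local extremum in $S$ at $f$" (local maximum or local minimum) is with respect to the sup norm: there is $\epsilon>0$ such that $J(y)-J(f)$ has constant sign ($\le 0$ for a maximum, $\ge0$ for a minimum) for all $y\in S$ with $\sup_{t\in D}|y(t)-f(t)|<\epsilon$. *)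

theory Defs
  imports "HOL-Analysis.Analysis"
begin

definition grid_from :: "real \<Rightarrow> real set" where
  "grid_from a = {a + real k | k. True}"

definition grid_upto :: "real \<Rightarrow> real set" where
  "grid_upto b = {b - real k | k. True}"

text \<open>The grid \<open>{a, a+1, \<dots>, b}\<close>; empty if \<open>b < a\<close>. It also serves as the range of the
  sums below, so that empty sums are \<open>0\<close>. Used only when \<open>b - a\<close> is an integer.\<close>

definition grid :: "real \<Rightarrow> real \<Rightarrow> real set" where
  "grid a b = grid_from a \<inter> grid_upto b"

definition rho :: "real \<Rightarrow> real" where
  "rho t = t - 1"

definition nabla :: "(real \<Rightarrow> real) \<Rightarrow> real \<Rightarrow> real" where
  "nabla h t = h t - h (t - 1)"

definition fwd_diff :: "(real \<Rightarrow> real) \<Rightarrow> real \<Rightarrow> real" where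
  "fwd_diff h t = h (t + 1) - h t"

text \<open>The poles of \<open>Gamma\<close> play no role: below, \<open>rising\<close> is applied only with \<open>t \<ge> 1\<close>
  and \<open>-1 < \<beta> < 0\<close>.\<close>

definition rising :: "real \<Rightarrow> real \<Rightarrow> real" where
  "rising t \<beta> = Gamma (t + \<beta>) / Gamma t"

definition frac_ord :: "real \<Rightarrow> nat" where
  "frac_ord \<alpha> = nat (\<lfloor>\<alpha>\<rfloor> + 1)"

text \<open>The iterated differences also evaluate the bracketed sum at points \<open>t\<close> outside the
  stated range (below \<open>c + 1\<close>, respectively above \<open>b - 1\<close>); there the sum is empty.\<close>

definition nabla_left :: "real \<Rightarrow> real \<Rightarrow> (real \<Rightarrow> real) \<Rightarrow> real \<Rightarrow> real" where
  "nabla_left \<alpha> c y =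
     (nabla ^^ frac_ord \<alpha>)
       (\<lambda>t. 1 / Gamma (real (frac_ord \<alpha>) - \<alpha>) *
         (\<Sum>s\<in>grid (c + 1) t. rising (t - rho s) (real (frac_ord \<alpha>) - \<alpha> - 1) * y s))"

definition nabla_right :: "real \<Rightarrow> real \<Rightarrow> (real \<Rightarrow> real) \<Rightarrow> real \<Rightarrow> real" where
  "nabla_right \<alpha> b g t =
     (- 1) ^ frac_ord \<alpha> *
     (fwd_diff ^^ frac_ord \<alpha>)
       (\<lambda>t. 1 / Gamma (real (frac_ord \<alpha>) - \<alpha>) *
         (\<Sum>s\<in>grid t (b - 1). rising (s - rho t) (real (frac_ord \<alpha>) - \<alpha> - 1) * g s)) t"

text \<open>Functions \<open>D \<rightarrow> \<real>\<close> are represented by functions on \<open>real\<close> that are \<open>undefined\<close>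
  off \<open>D\<close>.\<close>

definition admissible :: "real set \<Rightarrow> real \<Rightarrow> real \<Rightarrow> (real \<Rightarrow> real) set" where
  "admissible D a A = {y \<in> D \<rightarrow>\<^sub>E UNIV. bounded (y ` D) \<and> y a = A}"

definition local_max_in ::
  "real set \<Rightarrow> (real \<Rightarrow> real) set \<Rightarrow> ((real \<Rightarrow> real) \<Rightarrow> real) \<Rightarrow> (real \<Rightarrow> real) \<Rightarrow> bool" where
  "local_max_in D S J f \<longleftrightarrow> f \<in> S \<and>
     (\<exists>\<epsilon>>0. \<forall>y\<in>S. (SUP t\<in>D. \<bar>y t - f t\<bar>) < \<epsilon> \<longrightarrow> J y - J f \<le> 0)"

definition local_min_in ::
  "real set \<Rightarrow> (real \<Rightarrow> real) set \<Rightarrow> ((real \<Rightarrow> real) \<Rightarrow> real) \<Rightarrow> (real \<Rightarrow> real) \<Rightarrow> bool" where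
  "local_min_in D S J f \<longleftrightarrow> f \<in> S \<and>
     (\<exists>\<epsilon>>0. \<forall>y\<in>S. (SUP t\<in>D. \<bar>y t - f t\<bar>) < \<epsilon> \<longrightarrow> J y - J f \<ge> 0)"

definition local_extremum_in ::
  "real set \<Rightarrow> (real \<Rightarrow> real) set \<Rightarrow> ((real \<Rightarrow> real) \<Rightarrow> real) \<Rightarrow> (real \<Rightarrow> real) \<Rightarrow> bool" where
  "local_extremum_in D S J f \<longleftrightarrow> local_max_in D S J f \<or> local_min_in D S J f"

definition frac_functional ::
  "(real \<Rightarrow> real \<Rightarrow> real \<Rightarrow> real) \<Rightarrow> real \<Rightarrow> real \<Rightarrow> real \<Rightarrow> (real \<Rightarrow> real) \<Rightarrow> real" where
  "frac_functional L \<alpha> a b y =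
     (\<Sum>t\<in>grid (a + 1) (b - 1). L t (y t) (nabla_left \<alpha> (a - 1) y t))"

end

theory Submission imports Defs begin

text \<open>On the grid, both fractional differences are sums against one convolution kernel
  \<open>c\<close>: the left difference of \<open>y\<close> at \<open>t\<close> is \<open>\<Sum>s. c (t - s) * y s\<close>, and the right
  difference of \<open>g\<close> at \<open>t\<close> is \<open>\<Sum>s. c (s - t) * g s\<close>, so they are transposes of
  each other (summation by parts). Perturbing \<open>f\<close> at the single point \<open>s\<close> by \<open>e\<close>
  therefore moves \<open>J\<close> at first order by \<open>e\<close> times the left-hand side of the
  Euler-Lagrange equation at \<open>s\<close>, and Fermat's theorem makes this vanish.\<close>

lemma mem_grid_iff: "s \<in> grid a b \<longleftrightarrow> s - a \<in> \<nat> \<and> b - s \<in> \<nat>"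
proof -
  have "s \<in> grid_from a \<longleftrightarrow> s - a \<in> \<nat>"
    unfolding grid_from_def Nats_def by (auto simp: algebra_simps)
  moreover have "s \<in> grid_upto b \<longleftrightarrow> b - s \<in> \<nat>"
    unfolding grid_upto_def Nats_def by (auto simp: algebra_simps)
  ultimately show ?thesis by (simp add: grid_def)
qed

lemma finite_grid: "finite (grid a b)"
proof (rule finite_subset)
  show "grid a b \<subseteq> (\<lambda>k. a + real k) ` {..nat \<lceil>b - a\<rceil>}"
  proof
    fix s assume "s \<in> grid a b"
    then obtain k where k: "s = a + real k" and "s \<in> grid_upto b"
      unfolding grid_def grid_from_def by blast
    then obtain l where "a + real k = b - real l"
      unfolding grid_upto_def by auto
    then have "k \<le> nat \<lceil>b - a\<rceil>"
      using of_nat_ceiling[of "b - a"] by linarith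
    with k show "s \<in> (\<lambda>k. a + real k) ` {..nat \<lceil>b - a\<rceil>}" by blast
  qed
qed simp

text \<open>Differencing in \<open>t\<close> needs a summation range that stays put. This lemma and
  \<open>grid_from_shrink\<close> cut the moving range out of a fixed one by a condition that the
  kernel can absorb.\<close>

lemma grid_upto_shrink:
  assumes "m - t \<in> \<nat>"
  shows "grid a t = {s \<in> grid a m. t - s \<in> \<nat>}"
proof -
  have "m - s \<in> \<nat>" if "t - s \<in> \<nat>" for s
    using Nats_add[OF assms that] by simp
  then show ?thesis by (auto simp: mem_grid_iff)
qed

lemma grid_from_shrink:
  assumes "t - m \<in> \<nat>"
  shows "grid t b = {s \<in> grid m b. s - t \<in> \<nat>}"
proof -
  have "s - m \<in> \<nat>" if "s - t \<in> \<nat>" for s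
    using Nats_add[OF assms that] by simp
  then show ?thesis by (auto simp: mem_grid_iff)
qed

text \<open>\<open>nabla ^^ n\<close> at \<open>t\<close> looks only at \<open>t\<close>,
  \<open>t - 1\<close>, and so on. Agreement is asked for there alone because the fixed-range
  formula is established only at points \<open>u\<close> with
  \<open>m - u \<in> \<nat>\<close>.\<close>

lemma funpow_nabla_cong:
  assumes "\<And>k. F (t - real k) = G (t - real k)"
  shows "(nabla ^^ n) F t = (nabla ^^ n) G t"
proof -
  have "(nabla ^^ n) F (t - real k) = (nabla ^^ n) G (t - real k)" for k
  proof (induction n arbitrary: k)
    case (Suc n)
    show ?case
      using Suc[of k] Suc[of "Suc k"] by (simp add: nabla_def[of "(nabla ^^ n) _"] diff_diff_eq add.commute)
  qed (simp add: assms)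
  from this[of 0] show ?thesis by simp
qed

lemma funpow_fwd_diff_cong:
  assumes "\<And>k. F (t + real k) = G (t + real k)"
  shows "(fwd_diff ^^ n) F t = (fwd_diff ^^ n) G t"
proof -
  have "(fwd_diff ^^ n) F (t + real k) = (fwd_diff ^^ n) G (t + real k)" for k
  proof (induction n arbitrary: k)
    case (Suc n)
    show ?case
      using Suc[of k] Suc[of "Suc k"] by (simp add: fwd_diff_def[of "(fwd_diff ^^ n) _"] add_ac)
  qed (simp add: assms)
  from this[of 0] show ?thesis by simp
qed

text \<open>\<open>nabla\<close> is linear and commutes with translations, so over a fixed index set
  it passes onto the kernel.\<close>

lemma funpow_nabla_convolution:
  "(nabla ^^ n) (\<lambda>t. \<Sum>s\<in>I. k (t - s) * y s) = (\<lambda>t. \<Sum>s\<in>I. (nabla ^^ n) k (t - s) * y s)"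
proof (induction n)
  case (Suc n)
  then show ?case
    by (simp add: nabla_def fun_eq_iff diff_diff_eq left_diff_distrib sum_subtractf add.commute)
qed simp

text \<open>As \<open>t\<close> enters through \<open>s - t\<close>, a forward step in
  \<open>t\<close> is a backward step of \<open>k\<close>; each \<open>fwd_diff\<close> thus becomes
  \<open>nabla\<close> on the kernel and a factor \<open>-1\<close>.\<close>

lemma funpow_fwd_diff_convolution:
  "(fwd_diff ^^ n) (\<lambda>t. \<Sum>s\<in>I. k (s - t) * g s) =
    (\<lambda>t. (- 1) ^ n * (\<Sum>s\<in>I. (nabla ^^ n) k (s - t) * g s))"
proof (induction n)
  case (Suc n)
  then show ?case
    by (simp add: nabla_def fwd_diff_def fun_eq_iff diff_diff_eq left_diff_distrib
        right_diff_distrib sum_subtractf)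
qed simp

text \<open>For \<open>x = t - s\<close> the argument \<open>x + 1\<close> is
  \<open>t - rho s\<close>. The value \<open>0\<close> off \<nat> encodes the moving end of the
  summation range.\<close>

definition frac_sum_kernel :: "real \<Rightarrow> real \<Rightarrow> real" where
  "frac_sum_kernel \<alpha> x = (if x \<in> \<nat> then
     1 / Gamma (real (frac_ord \<alpha>) - \<alpha>) * rising (x + 1) (real (frac_ord \<alpha>) - \<alpha> - 1) else 0)"

definition frac_diff_kernel :: "real \<Rightarrow> real \<Rightarrow> real" where
  "frac_diff_kernel \<alpha> = (nabla ^^ frac_ord \<alpha>) (frac_sum_kernel \<alpha>)"

lemma nabla_left_eq_convolution:
  assumes "m - t \<in> \<nat>"
  shows "nabla_left \<alpha> c y t = (\<Sum>s\<in>grid (c + 1) m. frac_diff_kernel \<alpha> (t - s) * y s)"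
proof -
  let ?G = "\<lambda>t. \<Sum>s\<in>grid (c + 1) m. frac_sum_kernel \<alpha> (t - s) * y s"
  have sum_eq: "1 / Gamma (real (frac_ord \<alpha>) - \<alpha>) *
      (\<Sum>s\<in>grid (c + 1) u. rising (u - rho s) (real (frac_ord \<alpha>) - \<alpha> - 1) * y s) = ?G u"
    if "m - u \<in> \<nat>" for u
    unfolding grid_upto_shrink[OF that] sum_distrib_left
    by (rule sum.mono_neutral_cong_left)
      (auto simp: finite_grid frac_sum_kernel_def rho_def algebra_simps)
  \<comment> \<open>Iterated backward differences reach only downwards, so every point evaluated
    stays at or below the fixed end \<open>m\<close>.\<close>
  have "m - (t - real k) \<in> \<nat>" for k
    using Nats_add[OF assms of_nat_in_Nats[of k]] by (simp add: algebra_simps)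
  then have "nabla_left \<alpha> c y t = (nabla ^^ frac_ord \<alpha>) ?G t"
    unfolding nabla_left_def by (intro funpow_nabla_cong sum_eq)
  then show ?thesis by (simp add: funpow_nabla_convolution frac_diff_kernel_def)
qed

lemma nabla_right_eq_convolution:
  assumes "t - m \<in> \<nat>"
  shows "nabla_right \<alpha> b g t = (\<Sum>s\<in>grid m (b - 1). frac_diff_kernel \<alpha> (s - t) * g s)"
proof -
  let ?G = "\<lambda>t. \<Sum>s\<in>grid m (b - 1). frac_sum_kernel \<alpha> (s - t) * g s"
  have sum_eq: "1 / Gamma (real (frac_ord \<alpha>) - \<alpha>) *
      (\<Sum>s\<in>grid u (b - 1). rising (s - rho u) (real (frac_ord \<alpha>) - \<alpha> - 1) * g s) = ?G u"
    if "u - m \<in> \<nat>" for u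
    unfolding grid_from_shrink[OF that] sum_distrib_left
    by (rule sum.mono_neutral_cong_left)
      (auto simp: finite_grid frac_sum_kernel_def rho_def algebra_simps)
  have "t + real k - m \<in> \<nat>" for k
    using Nats_add[OF assms of_nat_in_Nats[of k]] by (simp add: algebra_simps)
  then have "nabla_right \<alpha> b g t = (- 1) ^ frac_ord \<alpha> * (fwd_diff ^^ frac_ord \<alpha>) ?G t"
    unfolding nabla_right_def by (intro arg_cong2[where f = "(*)"] refl funpow_fwd_diff_cong sum_eq)
  \<comment> \<open>The sign produced by the forward differences cancels the one in
    \<open>nabla_right\<close>, which leaves the same kernel as for the left difference.\<close>
  then show ?thesis
    by (simp add: funpow_fwd_diff_convolution frac_diff_kernel_def flip: mult.assoc power_mult_distrib)
qed

lemma has_real_derivative_along_line: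
  fixes F :: "real \<Rightarrow> real \<Rightarrow> real"
  assumes "(\<lambda>(u, v). F u v) differentiable (at (u, v))"
  shows "((\<lambda>e. F (u + e * p) (v + e * q)) has_real_derivative
    p * deriv (\<lambda>x. F x v) u + q * deriv (\<lambda>x. F u x) v) (at 0)"
proof -
  obtain T where T: "((\<lambda>(u, v). F u v) has_derivative T) (at (u, v))"
    using assms by (auto simp: differentiable_def)
  then interpret T: linear T by (rule has_derivative_linear)
  \<comment> \<open>The direction stays general: the axis directions identify
    \<open>T (1, 0)\<close> and \<open>T (0, 1)\<close> as the partial derivatives, and
    \<open>(p, q)\<close> then gives the claim.\<close>
  have line: "((\<lambda>e. F (u + e * p') (v + e * q')) has_real_derivative
      p' * T (1, 0) + q' * T (0, 1)) (at 0)" for p' q'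
  proof -
    have "((\<lambda>e. (u + e * p', v + e * q')) has_derivative (\<lambda>e. (e * p', e * q'))) (at 0)"
      by (auto intro!: derivative_eq_intros)
    from has_derivative_compose[OF this, of "\<lambda>(u, v). F u v" T] T
    have "((\<lambda>e. F (u + e * p') (v + e * q')) has_derivative (\<lambda>e. T (e * p', e * q'))) (at 0)"
      by simp
    moreover have "T (e * p', e * q') = (p' * T (1, 0) + q' * T (0, 1)) * e" for e
    proof -
      have "(e * p', e * q') = (e * p') *\<^sub>R (1, 0) + (e * q') *\<^sub>R (0, 1::real)" by simp
      then show ?thesis by (simp only: T.add T.scale) (simp add: algebra_simps)
    qed
    ultimately show ?thesis by (simp add: has_field_derivative_def)
  qed
  have "((\<lambda>x. F x v) has_real_derivative T (1, 0)) (at u)"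
    using line[of 1 0] DERIV_shift[of "\<lambda>x. F x v" "T (1, 0)" 0 u] by (simp add: add.commute)
  moreover have "((\<lambda>x. F u x) has_real_derivative T (0, 1)) (at v)"
    using line[of 0 1] DERIV_shift[of "\<lambda>x. F u x" "T (0, 1)" 0 v] by (simp add: add.commute)
  ultimately show ?thesis using line[of p q] by (simp add: DERIV_imp_deriv)
qed

lemma admissible_fun_upd:
  assumes "f \<in> admissible (grid a b) a A" and "s \<in> grid a b" and "s \<noteq> a"
  shows "f(s := x) \<in> admissible (grid a b) a A"
  using assms by (auto simp: admissible_def finite_grid finite_imp_bounded PiE_iff extensional_def)

lemma SUP_fun_upd_le:
  assumes "s \<in> D"
  shows "(SUP t\<in>D. \<bar>(f(s := f s + e)) t - f t\<bar>) \<le> \<bar>e :: real\<bar>"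
  using assms by (intro cSUP_least) auto

text \<open>At \<open>e = 0\<close> the perturbed function is \<open>f\<close> itself, and for small
  \<open>e\<close> it stays in the sup-norm ball, so the one-variable map has a local extremum at
  \<open>0\<close>.\<close>

lemma local_extremum_derivative_zero:
  assumes ext: "local_extremum_in D S J f" and s: "s \<in> D"
    and S: "\<And>e. f(s := f s + e) \<in> S"
    and der: "((\<lambda>e. J (f(s := f s + e))) has_real_derivative d) (at 0)"
  shows "d = 0"
proof -
  have small: "(SUP t\<in>D. \<bar>(f(s := f s + e)) t - f t\<bar>) < \<epsilon>" if "\<bar>0 - e\<bar> < \<epsilon>" for e \<epsilon>
    using SUP_fun_upd_le[OF s, of f e] that by simp
  show ?thesis
    using ext unfolding local_extremum_in_def
  proof
    assume "local_max_in D S J f"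
    then obtain \<epsilon> where "\<epsilon> > 0"
      and "\<And>y. y \<in> S \<Longrightarrow> (SUP t\<in>D. \<bar>y t - f t\<bar>) < \<epsilon> \<Longrightarrow> J y - J f \<le> 0"
      by (auto simp: local_max_in_def)
    then show ?thesis
      using S small by (intro DERIV_local_max[OF der \<open>\<epsilon> > 0\<close>]) fastforce
  next
    assume "local_min_in D S J f"
    then obtain \<epsilon> where "\<epsilon> > 0"
      and "\<And>y. y \<in> S \<Longrightarrow> (SUP t\<in>D. \<bar>y t - f t\<bar>) < \<epsilon> \<Longrightarrow> J y - J f \<ge> 0"
      by (auto simp: local_min_in_def)
    then show ?thesis
      using S small by (intro DERIV_local_min[OF der \<open>\<epsilon> > 0\<close>]) fastforce
  qed
qed

theorem theorem3p1:
  fixes \<alpha> a b A :: real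
    and L :: "real \<Rightarrow> real \<Rightarrow> real \<Rightarrow> real"
    and f L1 L2 :: "real \<Rightarrow> real"
    and D :: "real set"
    and S :: "(real \<Rightarrow> real) set"
  assumes "\<alpha> > 0" and "\<alpha> \<notin> \<int>"
    and "a < b" and "b - a \<in> \<int>"
  defines "D \<equiv> grid a b"
    and "S \<equiv> admissible D a A"
    and "L1 \<equiv> \<lambda>s. deriv (\<lambda>u. L s u (nabla_left \<alpha> (a - 1) f s)) (f s)"
    and "L2 \<equiv> \<lambda>s. deriv (\<lambda>v. L s (f s) v) (nabla_left \<alpha> (a - 1) f s)"
  assumes "\<And>t. t \<in> D \<Longrightarrow> (\<lambda>(u, v). L t u v) differentiable_on UNIV"
    and "f \<in> S"
    and "local_extremum_in D S (frac_functional L \<alpha> a b) f"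
  shows "\<forall>s \<in> grid (a + 1) (b - 1). L1 s + nabla_right \<alpha> b L2 s = 0"
proof
  fix s assume s: "s \<in> grid (a + 1) (b - 1)"
  let ?T = "grid (a + 1) (b - 1)" and ?N = "nabla_left \<alpha> (a - 1)"
  let ?c = "\<lambda>t. frac_diff_kernel \<alpha> (t - s)"
  \<comment> \<open>The first membership gives differentiability of \<open>L t\<close>; the second
    makes \<open>s\<close> one of the points of the left difference's sum, which starts at
    \<open>a\<close>.\<close>
  have inner: "t \<in> grid a b" "t \<in> grid a (b - 1)" if "t \<in> ?T" for t
  proof -
    have t: "t - (a + 1) \<in> \<nat>" "b - 1 - t \<in> \<nat>" using that by (auto simp: mem_grid_iff)
    then show "t \<in> grid a b" "t \<in> grid a (b - 1)"
      using Nats_add[OF t(1) Nats_1] Nats_add[OF t(2) Nats_1] by (simp_all add: mem_grid_iff)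
  qed
  have "s \<noteq> a"
    using s by (auto simp: mem_grid_iff elim!: Nats_cases)
  have N: "?N (f(s := f s + e)) t = ?N f t + e * ?c t" if "t \<in> ?T" for t e
  proof -
    have "b - 1 - t \<in> \<nat>" using that by (simp add: mem_grid_iff)
    \<comment> \<open>With \<open>b - 1\<close> as fixed end, one range from
      \<open>(a - 1) + 1 = a\<close> serves every \<open>t\<close>.\<close>
    note conv = nabla_left_eq_convolution[OF this, of \<alpha> "a - 1", simplified]
    have "(\<Sum>r\<in>grid a (b - 1). frac_diff_kernel \<alpha> (t - r) * (f(s := f s + e)) r)
      = (\<Sum>r\<in>grid a (b - 1). frac_diff_kernel \<alpha> (t - r) * f r
          + (if r = s then e * ?c t else 0))"
      by (intro sum.cong) (auto simp: algebra_simps)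
    then show ?thesis
      using inner(2)[OF s] by (simp add: conv sum.distrib finite_grid)
  qed
  \<comment> \<open>Each summand moves along a line: the value of \<open>f\<close> changes only at
    \<open>s\<close>, while its left difference at any \<open>t\<close> moves at rate
    \<open>?c t\<close>.\<close>
  have J: "frac_functional L \<alpha> a b (f(s := f s + e)) =
      (\<Sum>t\<in>?T. L t (f t + e * (if t = s then 1 else 0)) (?N f t + e * ?c t))" for e
    unfolding frac_functional_def by (intro sum.cong) (auto simp: N)
  have "((\<lambda>e. frac_functional L \<alpha> a b (f(s := f s + e))) has_real_derivative
      (\<Sum>t\<in>?T. (if t = s then 1 else 0) * L1 t + ?c t * L2 t)) (at 0)"
    unfolding J L1_def L2_def
    using assms(9) inner(1)
    by (intro DERIV_sum has_real_derivative_along_line) (auto simp: D_def differentiable_on_def)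
  then have "(\<Sum>t\<in>?T. (if t = s then 1 else 0) * L1 t + ?c t * L2 t) = 0"
    using assms(10,11) inner(1)[OF s] \<open>s \<noteq> a\<close> unfolding D_def S_def
    by (intro local_extremum_derivative_zero[where f = f and s = s]) (auto intro: admissible_fun_upd)
  moreover have "(\<Sum>t\<in>?T. (if t = s then 1 else 0) * L1 t) = L1 s"
    using s by (simp add: finite_grid if_distrib[of "\<lambda>x. x * _"] cong: if_cong)
  \<comment> \<open>This is the transposition: read as a sum over \<open>t\<close>, the coefficients
    \<open>?c t\<close> are those of the right difference at \<open>s\<close>, with fixed end
    \<open>a + 1\<close>.\<close>
  moreover have "nabla_right \<alpha> b L2 s = (\<Sum>t\<in>?T. ?c t * L2 t)"
    using s by (intro nabla_right_eq_convolution) (simp add: mem_grid_iff)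
  ultimately show "L1 s + nabla_right \<alpha> b L2 s = 0" by (simp add: sum.distrib)
qed

end
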